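(* $\chi(G^2)\le 2\Delta(G)$ for every permutation graph $G$.
   Context: All graphs are simple. $\Delta(G)$ is the maximum degree of $G$ and $\chi$ denotes the chromatic number. The square $G^2$ is the graph on $V(G)$ in which two distinct vertices are adjacent iff their distance in $G$ is at most $2$. $G$ is a permutation graph if each vertex $v$ can be assigned a closed interval $I_v$ of the real line so that distinct $u,v$ are adjacent iff $I_u\subseteq I_v$ or $I_v\subseteq I_u$.
   Formalization: The graph is assumed to have at least one edge (Δ(G) ≥ 1), because for an edgeless graph with a vertex the bound fails: Δ(G) = 0 but χ(G²) = 1. *)

theory Defs
  imports "Graph_Theory.Graph_Theory"
begin

text \<open>
  A finite simple graph is a \<^locale>\<open>pair_graph\<close>: an undirected edge \<open>uv\<close> is represented by the two
  arcs \<open>(u, v)\<close> and \<open>(v, u)\<close>, so the degree of a vertex is its \<^const>\<open>out_degree\<close>.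
\<close>

text \<open>The inserted \<open>0\<close> only matters for the graph without vertices.\<close>

definition max_degree :: "'a pair_pre_digraph \<Rightarrow> nat" where
  "max_degree G = Max (insert 0 (out_degree (with_proj G) ` pverts G))"

text \<open>Shortest-path distance with unit weights; it is \<open>\<infinity>\<close> between different components.\<close>

definition graph_dist :: "'a pair_pre_digraph \<Rightarrow> 'a \<Rightarrow> 'a \<Rightarrow> ereal" where
  "graph_dist G u v = wf_digraph.\<mu> (with_proj G) (\<lambda>_. 1) u v"

definition graph_square :: "'a pair_pre_digraph \<Rightarrow> 'a pair_pre_digraph" where
  "graph_square G =
    \<lparr> pverts = pverts G,
      parcs = {(u, v). u \<in> pverts G \<and> v \<in> pverts G \<and> u \<noteq> v \<and> graph_dist G u v \<le> 2} \<rparr>"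

definition proper_coloring :: "'a pair_pre_digraph \<Rightarrow> nat \<Rightarrow> ('a \<Rightarrow> nat) \<Rightarrow> bool" where
  "proper_coloring G k c \<longleftrightarrow>
    c ` pverts G \<subseteq> {..<k} \<and> (\<forall>(u, v) \<in> parcs G. c u \<noteq> c v)"

text \<open>The minimum exists for every finite loopfree graph.\<close>

definition chromatic_number :: "'a pair_pre_digraph \<Rightarrow> nat" where
  "chromatic_number G = (LEAST k. \<exists>c. proper_coloring G k c)"

text \<open>
  The closed interval assigned to \<open>v\<close> is \<open>{l v..r v}\<close>; it is required to be nonempty.
\<close>

definition permutation_graph :: "'a pair_pre_digraph \<Rightarrow> bool" where
  "permutation_graph G \<longleftrightarrow> pair_graph G \<and>
    (\<exists>l r :: 'a \<Rightarrow> real.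
      (\<forall>v \<in> pverts G. l v \<le> r v) \<and>
      (\<forall>u \<in> pverts G. \<forall>v \<in> pverts G. u \<noteq> v \<longrightarrow>
        ((u, v) \<in> parcs G \<longleftrightarrow> {l u..r u} \<subseteq> {l v..r v} \<or> {l v..r v} \<subseteq> {l u..r u})))"

end

theory Submission
  imports Defs
begin

text \<open>
  Colour the square greedily by increasing left endpoint, ties by decreasing right endpoint.
  Let \<open>u\<close> precede \<open>v\<close> with distance at most 2. If \<open>u\<close> and \<open>v\<close> are adjacent, then \<open>I\<^sub>v \<subseteq> I\<^sub>u\<close>.
  Otherwise a common neighbour either contains both intervals or is contained in both. In the
  first case \<open>u\<close> is adjacent to the neighbour \<open>t\<close> of \<open>v\<close> with \<open>I\<^sub>v \<subseteq> I\<^sub>t\<close> reaching farthest to the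
  left; in the second case \<open>u\<close> is adjacent to the neighbour \<open>w\<close> of \<open>v\<close> with \<open>I\<^sub>w \<subseteq> I\<^sub>v\<close> ending
  first, and then all vertices \<open>u\<close> with \<open>I\<^sub>v \<subseteq> I\<^sub>u\<close> are adjacent to \<open>w\<close> too. Since \<open>v\<close> is itself a
  neighbour of \<open>t\<close> and of \<open>w\<close>, this leaves at most \<open>\<Delta> + (\<Delta> - 1)\<close> vertices \<open>u\<close>.
\<close>

text \<open>A vertex of small degree is removed, the rest coloured by induction, and some colour is
  left over for it. Degeneracy is assumed for all subsets so that it passes to
  \<open>V - {v}\<close>.\<close>

lemma greedy_coloring:
  fixes R :: "'a \<Rightarrow> 'a \<Rightarrow> bool"
  assumes "finite V" "symp R"
    and degenerate: "\<And>U. U \<subseteq> V \<Longrightarrow> U \<noteq> {} \<Longrightarrow> \<exists>v\<in>U. card {u \<in> U - {v}. R u v} < k"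
  shows "\<exists>c :: 'a \<Rightarrow> nat. c ` V \<subseteq> {..<k} \<and> (\<forall>u\<in>V. \<forall>v\<in>V. u \<noteq> v \<longrightarrow> R u v \<longrightarrow> c u \<noteq> c v)"
  using assms(1) degenerate
proof (induction V rule: finite_psubset_induct)
  case (psubset V)
  show ?case
  proof (cases "V = {}")
    case False
    then obtain v where v: "v \<in> V" and small: "card {u \<in> V - {v}. R u v} < k"
      using psubset.prems[of V] by blast
    have "V - {v} \<subset> V"
      using v by blast
    moreover have "\<exists>w\<in>U. card {u \<in> U - {w}. R u w} < k" if "U \<subseteq> V - {v}" "U \<noteq> {}" for U
      using psubset.prems[of U] that by blast
    ultimately obtain c :: "'a \<Rightarrow> nat" where c: "c ` (V - {v}) \<subseteq> {..<k}"
      and proper: "\<forall>u\<in>V - {v}. \<forall>w\<in>V - {v}. u \<noteq> w \<longrightarrow> R u w \<longrightarrow> c u \<noteq> c w"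
      using psubset.IH[of "V - {v}"] by blast
    let ?used = "c ` {u \<in> V - {v}. R u v}"
    have "card ?used < card {..<k}"
      using small card_image_le[of "{u \<in> V - {v}. R u v}" c] psubset.hyps by simp
    moreover have "finite ?used"
      using psubset.hyps by simp
    ultimately have "\<not> {..<k} \<subseteq> ?used"
      by (meson card_mono leD)
    then obtain n where n: "n < k" "n \<notin> ?used"
      by auto
    have "(c(v := n)) ` V \<subseteq> {..<k}"
      using c n by auto
    moreover have "\<forall>u\<in>V. \<forall>w\<in>V. u \<noteq> w \<longrightarrow> R u w \<longrightarrow> (c(v := n)) u \<noteq> (c(v := n)) w"
      using proper n \<open>symp R\<close> by (auto simp: symp_def)
    ultimately show ?thesis
      by blast
  qed simp
qed

text \<open>Containment one way or the other, in endpoint form; it is reflexive, so neighbourhoods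
  must exclude the vertex itself.\<close>

definition nested :: "('a \<Rightarrow> real) \<Rightarrow> ('a \<Rightarrow> real) \<Rightarrow> 'a \<Rightarrow> 'a \<Rightarrow> bool" where
  "nested l r u v \<longleftrightarrow> l v \<le> l u \<and> r u \<le> r v \<or> l u \<le> l v \<and> r v \<le> r u"

text \<open>Taking \<open>w = u\<close> shows that nested intervals are also related by \<open>nested2\<close>.\<close>

definition nested2 :: "'a set \<Rightarrow> ('a \<Rightarrow> real) \<Rightarrow> ('a \<Rightarrow> real) \<Rightarrow> 'a \<Rightarrow> 'a \<Rightarrow> bool" where
  "nested2 V l r u v \<longleftrightarrow> (\<exists>w\<in>V. nested l r u w \<and> nested l r w v)"

lemma symp_nested2: "symp (nested2 V l r)"
  unfolding symp_def nested2_def nested_def by blast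

lemma card_earlier_nested2:
  fixes l r :: "'a \<Rightarrow> real"
  assumes "finite V" "v \<in> V" "U \<subseteq> V"
    and last: "\<And>u. u \<in> U \<Longrightarrow> l u < l v \<or> l u = l v \<and> r v \<le> r u"
    and degree: "\<And>w. w \<in> V \<Longrightarrow> card {x \<in> V. x \<noteq> w \<and> nested l r w x} \<le> d"
    and "d \<ge> 1"
  shows "card {u \<in> U - {v}. nested2 V l r u v} < 2 * d"
proof -
  let ?N = "\<lambda>w. {x \<in> V. x \<noteq> w \<and> nested l r w x}"
  define A where "A = {u \<in> U - {v}. r v \<le> r u}"
  define B where "B = {u \<in> U. l u < l v \<and> r u < r v \<and> (\<exists>t\<in>V. l t \<le> l u \<and> r v \<le> r t)}"
  define C where "C = {u \<in> U. l u < l v \<and> r u < r v \<and> (\<exists>w\<in>V. l v \<le> l w \<and> r w \<le> r u)}"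
  \<comment> \<open>If the middle interval lies between those of \<open>u\<close> and
    \<open>v\<close>, these are nested, and \<open>last\<close> puts \<open>u\<close> into
    \<open>A\<close>. Otherwise it contains both or lies in both. Outside \<open>A\<close>,
    \<open>last\<close> forces \<open>l u < l v\<close>.\<close>
  have split: "{u \<in> U - {v}. nested2 V l r u v} \<subseteq> A \<union> B \<union> C"
  proof
    fix u
    assume "u \<in> {u \<in> U - {v}. nested2 V l r u v}"
    then obtain w where "u \<in> U" "u \<noteq> v" "w \<in> V" "nested l r u w" "nested l r w v"
      unfolding nested2_def by blast
    then show "u \<in> A \<union> B \<union> C"
      using last[of u] unfolding A_def B_def C_def nested_def by fastforce
  qed
  have fin: "finite (?N w)" for w
    using \<open>finite V\<close> by simp
  have pred_card: "card X \<le> d - 1" if "w \<in> V" "v \<notin> X" "insert v X \<subseteq> ?N w" for w X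
  proof -
    have "card (insert v X) \<le> d"
      using card_mono[OF fin that(3)] degree[OF \<open>w \<in> V\<close>] by linarith
    moreover have "finite X"
      using that(3) fin[of w] by (meson finite_subset finite_insert)
    ultimately show ?thesis
      using \<open>v \<notin> X\<close> by simp
  qed
  have cardB: "card B \<le> d - 1"
  proof (cases "B = {}")
    case False
    \<comment> \<open>Each witness \<open>s\<close> from \<open>B\<close> has
      \<open>l s < l v\<close>, so it lies in \<open>?T\<close>. A leftmost \<open>t\<close>
      satisfies \<open>l t \<le> l s \<le> l u\<close> and \<open>r u < r v \<le> r t\<close>, so it
      serves all of \<open>B\<close>.\<close>
    let ?T = "{t \<in> V - {v}. l t \<le> l v \<and> r v \<le> r t}"
    have "?T \<noteq> {}"
      using False unfolding B_def by fastforce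
    then obtain t where t: "t \<in> ?T" and leftmost: "\<And>s. s \<in> ?T \<Longrightarrow> l t \<le> l s"
      using ex_is_arg_min_if_finite[of ?T l] \<open>finite V\<close>
      by (auto simp: is_arg_min_linorder)
    have "insert v B \<subseteq> ?N t"
    proof
      fix u
      assume "u \<in> insert v B"
      then consider "u = v" | "u \<in> B"
        by blast
      then show "u \<in> ?N t"
      proof cases
        case 1
        then show ?thesis
          using t \<open>v \<in> V\<close> unfolding nested_def by auto
      next
        case 2
        then obtain s where s: "s \<in> V" "l s \<le> l u" "r v \<le> r s" and u: "u \<in> V" "l u < l v" "r u < r v"
          using \<open>U \<subseteq> V\<close> unfolding B_def by blast
        then have "l t \<le> l s"
          by (intro leftmost) auto
        then show ?thesis
          using t s u unfolding nested_def by auto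
      qed
    qed
    then show ?thesis
      using t by (intro pred_card[of t]) (auto simp: B_def)
  qed simp
  have cardAC: "card (A \<union> C) \<le> d"
  \<comment> \<open>Without a common inner neighbour only the degree of \<open>v\<close> bounds
    \<open>A\<close>, and no place is saved.\<close>
  proof (cases "C = {}")
    case True
    have "A \<union> C \<subseteq> ?N v"
      using True last \<open>U \<subseteq> V\<close> unfolding A_def nested_def by fastforce
    then show ?thesis
      using card_mono[OF fin] degree[OF \<open>v \<in> V\<close>] order_trans by blast
  next
    case False
    \<comment> \<open>The strict \<open>r w < r v\<close> keeps \<open>w\<close> apart from
      \<open>v\<close> and from all of \<open>A\<close>; witnesses from \<open>C\<close> satisfy it
      because \<open>r s \<le> r u < r v\<close>.\<close>
    let ?W = "{w \<in> V. l v \<le> l w \<and> r w < r v}"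
    have "?W \<noteq> {}"
      using False unfolding C_def by fastforce
    then obtain w where w: "w \<in> ?W" and first: "\<And>s. s \<in> ?W \<Longrightarrow> r w \<le> r s"
      using ex_is_arg_min_if_finite[of ?W r] \<open>finite V\<close>
      by (auto simp: is_arg_min_linorder)
    have "insert v (A \<union> C) \<subseteq> ?N w"
    proof
      fix u
      assume "u \<in> insert v (A \<union> C)"
      then consider "u = v" | "u \<in> A" | "u \<in> C"
        by blast
      then show "u \<in> ?N w"
      proof cases
        case 1
        then show ?thesis
          using w \<open>v \<in> V\<close> unfolding nested_def by auto
      next
        case 2
        then have "u \<in> V" "r v \<le> r u" "l u \<le> l v"
          using last \<open>U \<subseteq> V\<close> unfolding A_def by fastforce+
        then show ?thesis
          using w unfolding nested_def by auto
      next
        case 3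
        then obtain s where s: "s \<in> V" "l v \<le> l s" "r s \<le> r u" and u: "u \<in> V" "l u < l v" "r u < r v"
          using \<open>U \<subseteq> V\<close> unfolding C_def by blast
        then have "r w \<le> r s"
          by (intro first) auto
        then show ?thesis
          using w s u unfolding nested_def by auto
      qed
    qed
    then have "card (A \<union> C) \<le> d - 1"
      using w by (intro pred_card[of w]) (auto simp: A_def C_def)
    then show ?thesis
      by simp
  qed
  have "finite (A \<union> B \<union> C)"
    using finite_subset[OF \<open>U \<subseteq> V\<close> \<open>finite V\<close>] unfolding A_def B_def C_def by simp
  then have "card {u \<in> U - {v}. nested2 V l r u v} \<le> card (A \<union> B \<union> C)"
    by (rule card_mono[OF _ split])
  also have "\<dots> = card ((A \<union> C) \<union> B)"
    by (simp add: Un_ac)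
  also have "\<dots> \<le> card (A \<union> C) + card B"
    by (rule card_Un_le)
  \<comment> \<open>Subtraction is truncated, so \<open>d + (d - 1) < 2 * d\<close> fails for
    \<open>d = 0\<close>.\<close>
  also have "\<dots> < 2 * d"
    using cardAC cardB \<open>d \<ge> 1\<close> by linarith
  finally show ?thesis .
qed

lemma nested2_coloring:
  fixes l r :: "'a \<Rightarrow> real"
  assumes "finite V" "d \<ge> 1"
    and degree: "\<And>w. w \<in> V \<Longrightarrow> card {x \<in> V. x \<noteq> w \<and> nested l r w x} \<le> d"
  shows "\<exists>c :: 'a \<Rightarrow> nat. c ` V \<subseteq> {..<2 * d} \<and>
    (\<forall>u\<in>V. \<forall>v\<in>V. u \<noteq> v \<longrightarrow> nested2 V l r u v \<longrightarrow> c u \<noteq> c v)"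
proof (rule greedy_coloring[OF \<open>finite V\<close> symp_nested2])
  fix U
  assume U: "U \<subseteq> V" "U \<noteq> {}"
  then have "finite U"
    using \<open>finite V\<close> finite_subset by blast
  \<comment> \<open>The last vertex of \<open>U\<close> in the greedy order is found in two stages:
    greatest left endpoint, then least right endpoint.\<close>
  then obtain m where m: "m \<in> U" "\<And>u. u \<in> U \<Longrightarrow> l u \<le> l m"
    using ex_is_arg_min_if_finite[of U "\<lambda>u. - l u"] U by (auto simp: is_arg_min_linorder)
  let ?M = "{u \<in> U. l u = l m}"
  have "?M \<noteq> {}" "finite ?M"
    using m \<open>finite U\<close> by auto
  then obtain v where v: "v \<in> ?M" "\<And>u. u \<in> ?M \<Longrightarrow> r v \<le> r u"
    using ex_is_arg_min_if_finite[of ?M r] by (auto simp: is_arg_min_linorder)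
  have "l u < l v \<or> l u = l v \<and> r v \<le> r u" if "u \<in> U" for u
    using m(2)[OF that] v that by auto
  moreover have "v \<in> V"
    using v(1) U by blast
  ultimately have "card {u \<in> U - {v}. nested2 V l r u v} < 2 * d"
    using card_earlier_nested2[OF \<open>finite V\<close> _ U(1) _ degree \<open>d \<ge> 1\<close>] by blast
  then show "\<exists>v\<in>U. card {u \<in> U - {v}. nested2 V l r u v} < 2 * d"
    using v(1) by blast
qed

lemma graph_dist_le_2_cases:
  assumes "pair_wf_digraph G" "graph_dist G u v \<le> 2"
  obtains "u = v" | "(u, v) \<in> parcs G" | w where "(u, w) \<in> parcs G" "(w, v) \<in> parcs G"
proof -
  interpret pair_wf_digraph G
    by fact
  have cost: "awalk_cost (\<lambda>_. 1) p = real (length p)" for p :: "('a \<times> 'a) list"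
    by (induction p) (auto simp: awalk_cost_def)
  \<comment> \<open>Distance is an infimum of walk costs; a strict bound yields an actual walk, and
    integrality of lengths makes 3 sufficient.\<close>
  have "\<mu> (\<lambda>_. 1) u v < ereal 3"
    using assms(2) by (auto simp: graph_dist_def intro: le_less_trans)
  then obtain p where p: "awalk u p v" "length p < 3"
    unfolding \<mu>_def by (auto simp: INF_less_iff cost)
  consider "p = []" | e where "p = [e]" | e f where "p = [e, f]"
    using p(2) by (cases p rule: list.exhaust; cases "tl p"; cases "tl (tl p)") auto
  then show ?thesis
    using p(1) that by cases (auto simp: awalk_simps)
qed

lemma out_degree_eq_card_neighbours:
  "out_degree (with_proj G) w = card {x. (w, x) \<in> parcs G}"
proof -
  have "out_arcs (with_proj G) w = Pair w ` {x. (w, x) \<in> parcs G}"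
    by (auto simp: out_arcs_def)
  then show ?thesis
    by (simp add: out_degree_def card_image inj_on_def)
qed

lemma out_degree_le_max_degree:
  assumes "finite (pverts G)" "w \<in> pverts G"
  shows "out_degree (with_proj G) w \<le> max_degree G"
  unfolding max_degree_def using assms by (intro Max_ge) auto

theorem corollary16:
  fixes G :: "'a pair_pre_digraph"
  assumes "permutation_graph G"
    and "max_degree G \<ge> 1"
  shows "chromatic_number (graph_square G) \<le> 2 * max_degree G"
proof -
  let ?V = "pverts G"
  interpret pair_graph G
    using assms(1) by (simp add: permutation_graph_def)
  obtain l r :: "'a \<Rightarrow> real" where nonempty: "\<forall>v\<in>?V. l v \<le> r v"
    and intervals: "\<forall>u\<in>?V. \<forall>v\<in>?V. u \<noteq> v \<longrightarrow>
      ((u, v) \<in> parcs G \<longleftrightarrow> {l u..r u} \<subseteq> {l v..r v} \<or> {l v..r v} \<subseteq> {l u..r u})"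
    using assms(1) unfolding permutation_graph_def by blast
  \<comment> \<open>Nonemptiness makes set inclusion equivalent to the endpoint
    inequalities.\<close>
  have adj: "(u, v) \<in> parcs G \<longleftrightarrow> nested l r u v" if "u \<in> ?V" "v \<in> ?V" "u \<noteq> v" for u v
    using intervals nonempty that by (simp add: nested_def)
  have arcD: "u \<in> ?V" "v \<in> ?V" "u \<noteq> v" "nested l r u v" if "(u, v) \<in> parcs G" for u v
  proof -
    show "u \<in> ?V" "v \<in> ?V" "u \<noteq> v"
      using that wellformed' pair_no_loops by fastforce+
    then show "nested l r u v"
      using adj that by blast
  qed
  have "card {x \<in> ?V. x \<noteq> w \<and> nested l r w x} \<le> max_degree G" if "w \<in> ?V" for w
  proof -
    have "{x \<in> ?V. x \<noteq> w \<and> nested l r w x} = {x. (w, x) \<in> parcs G}"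
      using adj[OF that] arcD by blast
    then show ?thesis
      using out_degree_le_max_degree[OF pair_finite_verts that]
      by (simp add: out_degree_eq_card_neighbours)
  qed
  then obtain c :: "'a \<Rightarrow> nat" where c: "c ` ?V \<subseteq> {..<2 * max_degree G}"
    and proper: "\<forall>u\<in>?V. \<forall>v\<in>?V. u \<noteq> v \<longrightarrow> nested2 ?V l r u v \<longrightarrow> c u \<noteq> c v"
    using nested2_coloring[OF pair_finite_verts assms(2)] by blast
  have "nested2 ?V l r u v" if "u \<in> ?V" "u \<noteq> v" "graph_dist G u v \<le> 2" for u v
    using pair_wf_digraph_axioms that(3)
  proof (cases rule: graph_dist_le_2_cases)
    case 2
    moreover have "nested l r u u"
      by (simp add: nested_def)
    ultimately show ?thesis
      using arcD that(1) unfolding nested2_def by blast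
  next
    case (3 w)
    then show ?thesis
      using arcD unfolding nested2_def by blast
  qed (use that in simp)
  then have "proper_coloring (graph_square G) (2 * max_degree G) c"
    using c proper unfolding proper_coloring_def graph_square_def by auto
  then show ?thesis
    unfolding chromatic_number_def by (intro Least_le) blast
qed

end
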